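(* Let $p,q$ be distinct primes. For any subset $A\subset \mathbb{Z}_{pq}$, if $A$ is a positive-definite weak tile of $\mathbb{Z}_{pq}$, then $A$ is a translational tile of $\mathbb{Z}_{pq}$, i.e., there exists $B\subset \mathbb{Z}_{pq}$ such that $A\oplus B=\mathbb{Z}_{pq}$.
   Context: $\mathbb{Z}_{M}$ denotes the cyclic group of integers modulo $M$. For $f:\mathbb{Z}_M\to\mathbb{C}$, the Fourier transform is $\widehat f(\xi)=\sum_{z\in\mathbb{Z}_M} f(z)e^{-2\pi i z\xi/M}$ for $\xi\in\mathbb{Z}_M$, and convolution is $(f*g)(x)=\sum_{y\in\mathbb{Z}_M} f(x-y)g(y)$. $\mathbf{1}_A$ denotes the indicator function of $A$, and $\mathbf 1_{\mathbb{Z}_M}$ is the constant function $1$. A set $A\subset \mathbb{Z}_M$ is a positive-definite weak tile (pd-tile) of $\mathbb{Z}_M$ if there exists a function $f:\mathbb{Z}_M\to\mathbb{R}$ such that $f(0)=1$, $f(x)\ge 0$ for all $x$, $\widehat f(\xi)$ is real and $\ge 0$ for all $\xi$, and $\mathbf{1}_A*f=\mathbf{1}_{\mathbb{Z}_M}$. $A\oplus B=\mathbb{Z}_M$ means that every element of $\mathbb{Z}_M$ can be written uniquely as $a+b$ with $a\in A$ and $b\in B$ (addition modulo $M$). *)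

theory Defs
  imports "HOL-Analysis.Analysis" "HOL-Algebra.Elementary_Groups"
    "HOL-Computational_Algebra.Primes"
begin

text \<open>
  The cyclic group of integers modulo \<open>M\<close> is the library's \<^const>\<open>integer_mod_group\<close>; for
  \<open>M > 0\<close> its carrier is \<open>{0..<int M}\<close>. A function on the cyclic group is represented by a
  function on \<^typ>\<open>int\<close>, of which only the values on the carrier matter.
\<close>

definition cyclic_conv :: "nat \<Rightarrow> (int \<Rightarrow> 'a::comm_semiring_1) \<Rightarrow> (int \<Rightarrow> 'a) \<Rightarrow> int \<Rightarrow> 'a"
  where "cyclic_conv M f g x =
    (\<Sum>y\<in>carrier (integer_mod_group M).
       f (x \<otimes>\<^bsub>integer_mod_group M\<^esub> inv\<^bsub>integer_mod_group M\<^esub> y) * g y)"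

definition cyclic_fourier :: "nat \<Rightarrow> (int \<Rightarrow> complex) \<Rightarrow> int \<Rightarrow> complex"
  where "cyclic_fourier M f \<xi> =
    (\<Sum>z\<in>carrier (integer_mod_group M).
       f z * exp (- (2 * of_real pi * \<i> * of_int z * of_int \<xi> / of_nat M)))"

definition pd_tile :: "nat \<Rightarrow> int set \<Rightarrow> bool"
  where "pd_tile M A \<longleftrightarrow>
    A \<subseteq> carrier (integer_mod_group M) \<and>
    (\<exists>f :: int \<Rightarrow> real.
       f \<one>\<^bsub>integer_mod_group M\<^esub> = 1 \<and>
       (\<forall>x\<in>carrier (integer_mod_group M). f x \<ge> 0) \<and>
       (\<forall>\<xi>\<in>carrier (integer_mod_group M).
          cyclic_fourier M (\<lambda>x. complex_of_real (f x)) \<xi> \<in> \<real> \<and>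
          Re (cyclic_fourier M (\<lambda>x. complex_of_real (f x)) \<xi>) \<ge> 0) \<and>
       (\<forall>x\<in>carrier (integer_mod_group M). cyclic_conv M (indicator A) f x = 1))"

definition direct_sum_cyclic :: "nat \<Rightarrow> int set \<Rightarrow> int set \<Rightarrow> bool"
  where "direct_sum_cyclic M A B \<longleftrightarrow>
    A \<subseteq> carrier (integer_mod_group M) \<and> B \<subseteq> carrier (integer_mod_group M) \<and>
    (\<forall>x\<in>carrier (integer_mod_group M).
       \<exists>!ab. ab \<in> A \<times> B \<and> x = fst ab \<otimes>\<^bsub>integer_mod_group M\<^esub> snd ab)"

definition translational_tile :: "nat \<Rightarrow> int set \<Rightarrow> bool"
  where "translational_tile M A \<longleftrightarrow>
    (\<exists>B \<subseteq> carrier (integer_mod_group M). direct_sum_cyclic M A B)"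

end

theory Submission
  imports Defs
begin

text \<open>
  On the transform side a weak tiling \<open>1\<^sub>A * f = 1\<close> says that at every nonzero frequency the
  transform of \<open>A\<close> or that of \<open>f\<close> vanishes, and that \<open>card A\<close> times the total mass of \<open>f\<close>
  is \<open>p q\<close>. Since \<open>1\<^sub>A\<close> is integer valued, irreducibility of the cyclotomic polynomials makes
  its zero set a union of some of the three classes of frequencies of order \<open>p q\<close>, \<open>p\<close> and \<open>q\<close>.
  Below, \<open>A\<close> or \<open>f\<close> vanishing at an order means that its transform vanishes at those frequencies.

  If \<open>A\<close> vanishes at order \<open>p q\<close>, then \<open>1\<^sub>A\<close> is a function of the residue modulo \<open>p\<close> plus one
  of the residue modulo \<open>q\<close>; being 0/1-valued it depends on only one of them, say the first. Unless
  \<open>A\<close> is everything, all fibre sums of \<open>f\<close> modulo \<open>p\<close> are then equal, and they are at least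
  \<open>f 0 = 1\<close>; so \<open>f\<close> has mass at least \<open>p\<close>, and \<open>A\<close> is a single fibre.

  Otherwise \<open>f\<close> vanishes at order \<open>p q\<close>. If \<open>A\<close> vanishes at both orders \<open>p\<close> and \<open>q\<close>, its
  cardinality is divisible by \<open>p q\<close>. If it vanishes only at order \<open>p\<close>, then \<open>f\<close> is a function of
  the residue modulo \<open>p\<close>, so it has mass at least \<open>q\<close>; \<open>A\<close> is equidistributed modulo \<open>p\<close>
  with at most \<open>p\<close> elements, hence a transversal. If it vanishes at neither, \<open>f\<close> is constant and
  \<open>A\<close> is a singleton.
\<close>

section \<open>Integer polynomials at roots of unity\<close>

definition int_eval :: "int poly \<Rightarrow> 'a::comm_ring_1 \<Rightarrow> 'a"
  where "int_eval g z = poly (map_poly of_int g) z"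

lemma int_eval_0 [simp]: "int_eval 0 z = 0"
  by (simp add: int_eval_def)

lemma int_eval_pCons [simp]: "int_eval (pCons a g) z = of_int a + z * int_eval g z"
  by (simp add: int_eval_def map_poly_pCons)

lemma int_eval_add [simp]: "int_eval (g + h) z = int_eval g z + int_eval h z"
proof (induction g h rule: poly_induct2)
  case (pCons a p b q)
  then show ?case by (simp add: algebra_simps)
qed simp

lemma int_eval_sum: "int_eval (\<Sum>i\<in>I. g i) z = (\<Sum>i\<in>I. int_eval (g i) z)"
  by (induction I rule: infinite_finite_induct) auto

lemma int_eval_smult [simp]: "int_eval (smult c g) z = of_int c * int_eval g z"
  by (induction g) (simp_all add: algebra_simps)

lemma int_eval_mult [simp]: "int_eval (g * h) z = int_eval g z * int_eval h z"
  by (induction g) (simp_all add: algebra_simps)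

lemma int_eval_monom [simp]: "int_eval (monom c n) z = of_int c * z ^ n"
  by (simp add: int_eval_def map_poly_monom poly_monom)

lemma int_eval_pcompose: "int_eval (pcompose g h) z = int_eval g (int_eval h z)"
  by (induction g) (simp_all add: pcompose_pCons)

section \<open>Frobenius congruences modulo a prime\<close>

text \<open>The inner binomial coefficients are multiples of \<open>r\<close>. The ring is general
  because both the integers and \<open>int poly\<close> are needed.\<close>

lemma prime_dvd_power_add_diff:
  fixes a b :: "'a::comm_ring_1"
  assumes "prime r"
  shows "of_nat r dvd (a + b) ^ r - (a ^ r + b ^ r)"
proof -
  obtain s where s: "r = Suc s"
    using prime_gt_0_nat[OF assms] gr0_implies_Suc by blast
  have "(a + b) ^ r = (\<Sum>k\<le>r. of_nat (r choose k) * a ^ k * b ^ (r - k))"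
    by (rule binomial_ring)
  also have "{..r} = insert 0 (insert r {1..<r})"
    using s by auto
  also have "(\<Sum>k\<in>\<dots>. of_nat (r choose k) * a ^ k * b ^ (r - k))
      = a ^ r + b ^ r + (\<Sum>k\<in>{1..<r}. of_nat (r choose k) * a ^ k * b ^ (r - k))"
    using s by (subst sum.insert; simp)+
  finally have "(a + b) ^ r - (a ^ r + b ^ r)
      = (\<Sum>k\<in>{1..<r}. of_nat (r choose k) * a ^ k * b ^ (r - k))"
    by simp
  also have "of_nat r dvd \<dots>"
  proof (rule dvd_sum)
    fix k assume "k \<in> {1..<r}"
    then have "r dvd (r choose k)"
      using assms by (intro dvd_choose_prime) auto
    then have "(of_nat r :: 'a) dvd of_nat (r choose k)"
      by auto
    then show "of_nat r dvd of_nat (r choose k) * a ^ k * b ^ (r - k)"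
      by (simp add: dvd_mult2)
  qed
  finally show ?thesis .
qed

text \<open>Fermat's little theorem, from additivity of the \<open>r\<close>-th power modulo
  \<open>r\<close>; it handles the constant terms in the polynomial version.\<close>

lemma prime_dvd_int_power_diff:
  fixes a :: int
  assumes "prime r"
  shows "int r dvd a ^ r - a"
proof (induction a rule: int_induct[where k = 0])
  case base
  then show ?case using prime_gt_0_nat[OF assms] by (simp add: zero_power)
next
  case (step1 i)
  have "int r dvd ((i + 1) ^ r - (i ^ r + 1 ^ r)) + (i ^ r - i)"
    using step1 prime_dvd_power_add_diff[OF assms, of i 1] by (intro dvd_add) simp_all
  then show ?case by (simp add: algebra_simps)
next
  case (step2 i)
  have "int r dvd (i ^ r - i) - ((i - 1 + 1) ^ r - ((i - 1) ^ r + 1 ^ r))"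
    using step2 prime_dvd_power_add_diff[OF assms, of "i - 1" 1] by (rule_tac dvd_diff) simp_all
  then show ?case by (simp add: algebra_simps)
qed

text \<open>Additivity of the \<open>r\<close>-th power splits off the constant coefficient, to
  which Fermat applies; the part \<open>X * g\<close> is covered by induction.\<close>

lemma prime_dvd_power_diff_pcompose_monom:
  fixes g :: "int poly"
  assumes "prime r"
  shows "of_nat r dvd g ^ r - pcompose g (monom 1 r)"
proof (induction g)
  case 0
  then show ?case using prime_gt_0_nat[OF assms] by (simp add: zero_power)
next
  case (pCons a g)
  define X :: "int poly" where "X = monom 1 1"
  have g: "pCons a g = [:a:] + X * g"
    by (simp add: X_def monom_altdef)
  have X: "monom 1 r = X ^ r"
    by (simp add: X_def monom_power)
  define C where "C = [:a:]"
  have "of_nat r dvd (pCons a g) ^ r - (C ^ r + (X * g) ^ r)"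
    unfolding g C_def by (rule prime_dvd_power_add_diff[OF assms])
  moreover have "(of_nat r :: int poly) dvd C ^ r - C"
  proof -
    have "[:int r:] dvd [:a ^ r - a:]"
      using prime_dvd_int_power_diff[OF assms] by simp
    then show ?thesis
      by (simp add: C_def of_nat_poly poly_const_pow)
  qed
  moreover have "of_nat r dvd X ^ r * (g ^ r - pcompose g (monom 1 r))"
    using pCons by (rule_tac dvd_mult)
  ultimately have "of_nat r dvd ((pCons a g) ^ r - (C ^ r + (X * g) ^ r)) + (C ^ r - C)
      + X ^ r * (g ^ r - pcompose g (monom 1 r))"
    by (intro dvd_add)
  moreover have "pcompose (pCons a g) (monom 1 r) = C + X ^ r * pcompose g (monom 1 r)"
    by (simp add: C_def X pcompose_pCons)
  ultimately show ?case
    by (simp add: power_mult_distrib algebra_simps)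
qed

section \<open>Minimal polynomials over the integers\<close>

text \<open>Gauss's lemma: multiplicativity of the content forces all of \<open>c\<close> into the
  cofactor of \<open>m\<close>.\<close>

lemma primitive_dvd_smult_cancel:
  fixes m g :: "int poly"
  assumes "content m = 1" "m dvd smult c g" "c \<noteq> 0"
  shows "m dvd g"
proof -
  obtain k where k: "smult c g = m * k"
    using assms(2) by (auto elim: dvdE)
  have "c dvd content k"
  proof -
    have "content (smult c g) = content k"
      unfolding k by (simp add: content_mult assms)
    then show ?thesis
      by (metis content_smult dvd_normalize_iff dvd_triv_left normalize_dvd_iff dvd_trans)
  qed
  then have "[:c:] dvd k"
    by (simp add: const_poly_dvd_iff_dvd_content)
  then obtain l where "k = [:c:] * l" by (auto elim: dvdE)
  then have "smult c g = smult c (m * l)" using k by simp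
  then show ?thesis
    using assms(3) by (metis dvd_triv_left smult_cancel)
qed

text \<open>The generator is the primitive part of an annihilating polynomial of least degree.
  Pseudo-division keeps everything integral, the remainder vanishes by minimality, and Gauss's lemma
  removes the multiplier \<open>a\<close>.\<close>

lemma exists_generator_of_annihilating_int_polys:
  fixes \<zeta> :: complex and g :: "int poly"
  assumes "g \<noteq> 0" "int_eval g \<zeta> = 0"
  obtains m :: "int poly" where "int_eval m \<zeta> = 0" "m \<noteq> 0"
    "\<And>h. int_eval h \<zeta> = 0 \<Longrightarrow> m dvd h"
proof -
  define P where "P m \<longleftrightarrow> m \<noteq> 0 \<and> int_eval m \<zeta> = 0" for m :: "int poly"
  obtain m0 where m0: "P m0" and min: "\<And>h. P h \<Longrightarrow> degree m0 \<le> degree h"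
    using ex_has_least_nat[of P g degree] assms unfolding P_def by blast
  define m where "m = primitive_part m0"
  have c: "content m = 1" and deg: "degree m = degree m0" and "m \<noteq> 0"
    using m0 by (auto simp: m_def P_def)
  have "int_eval m0 \<zeta> = of_int (content m0) * int_eval m \<zeta>"
    by (metis m_def content_times_primitive_part int_eval_smult)
  then have root: "int_eval m \<zeta> = 0"
    using m0 by (auto simp: P_def)
  have "m dvd h" if h: "int_eval h \<zeta> = 0" for h
  proof -
    define b where "b = pseudo_mod h m"
    obtain a q where aq: "a \<noteq> 0" "smult a h = m * q + b"
      using pseudo_mod(1)[OF \<open>m \<noteq> 0\<close>, of h] unfolding b_def by blast
    have "int_eval b \<zeta> = int_eval (smult a h) \<zeta> - int_eval (m * q) \<zeta>"
      unfolding aq(2) by simp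
    then have "int_eval b \<zeta> = 0"
      using h root by simp
    moreover have "b = 0 \<or> degree b < degree m"
      using pseudo_mod(2)[OF \<open>m \<noteq> 0\<close>] b_def by blast
    ultimately have "b = 0"
      using min[of b] deg unfolding P_def by linarith
    then show ?thesis
      using aq primitive_dvd_smult_cancel[OF c _ aq(1)] by simp
  qed
  with root \<open>m \<noteq> 0\<close> show ?thesis using that by blast
qed

text \<open>Dedekind's argument for the irreducibility of cyclotomic polynomials, carried out in
  \<open>\<int>[x]/(m)\<close> instead of over a finite field: the derivative of \<open>x\<^sup>n - 1 = m k\<close> makes
  \<open>k\<close> divide \<open>n\<close> there, while \<open>m\<close> divides \<open>k\<^sup>r\<close> modulo \<open>r\<close> if \<open>\<zeta>\<^sup>r\<close> is a root of \<open>k\<close>.\<close>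
lemma int_eval_root_of_unity_prime_power:
  fixes \<zeta> :: complex
  assumes \<zeta>: "\<zeta> ^ n = 1" and r: "prime r" "\<not> r dvd n" and g: "int_eval g \<zeta> = 0"
  shows "int_eval g (\<zeta> ^ r) = 0"
proof -
  have n: "n > 0" using r by (cases n) auto
  define X :: "int poly" where "X = monom 1 n - 1"
  have evX: "int_eval X z = z ^ n - 1" for z :: complex
  proof -
    have "X = monom 1 n + [:-1:]" by (simp add: X_def one_pCons)
    then show ?thesis by simp
  qed
  have Xlead: "coeff X n = 1" 
    using n by (simp add: X_def)
  then have "X \<noteq> 0" by auto
  obtain m where m: "int_eval m \<zeta> = 0" "m \<noteq> 0" and mdvd: "\<And>h. int_eval h \<zeta> = 0 \<Longrightarrow> m dvd h"
    using exists_generator_of_annihilating_int_polys[OF \<open>X \<noteq> 0\<close>, of \<zeta>] \<zeta> evX by auto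
  obtain k where k: "X = m * k"
    using mdvd[of X] evX \<zeta> by (auto elim: dvdE)
  have "degree m > 0"
  proof (rule ccontr)
    assume "\<not> degree m > 0"
    then obtain a where "m = [:a:]"
      by (metis degree_eq_zeroE gr0I)
    with m show False by auto
  qed
  \<comment> \<open>Since \<open>m\<close> divides the monic \<open>X\<close>, its leading
    coefficient is a unit; this lets coefficients be peeled off from the top below.\<close>
  have lead: "lead_coeff m dvd 1"
  proof -
    have "degree X = n"
    proof (rule antisym)
      show "degree X \<le> n"
        unfolding X_def by (intro degree_diff_le degree_monom_le) simp
    qed (use Xlead in \<open>auto intro: le_degree\<close>)
    with Xlead have "lead_coeff X = 1" by simp
    then show ?thesis
      unfolding k lead_coeff_mult by (metis dvd_triv_left)
  qed
  have mr: "int_eval m (\<zeta> ^ r) = 0"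
  proof (rule ccontr)
    assume "int_eval m (\<zeta> ^ r) \<noteq> 0"
    moreover have "int_eval X (\<zeta> ^ r) = 0"
      using \<zeta> by (simp add: evX flip: power_mult) (simp add: mult.commute power_mult)
    ultimately have "int_eval k (\<zeta> ^ r) = 0"
      unfolding k by simp
    then have "int_eval (pcompose k (monom 1 r)) \<zeta> = 0"
      by (simp add: int_eval_pcompose)
    then obtain a where a: "pcompose k (monom 1 r) = m * a"
      using mdvd by (auto elim: dvdE)
    obtain b where b: "k ^ r - pcompose k (monom 1 r) = of_nat r * b"
      using prime_dvd_power_diff_pcompose_monom[OF r(1)] by (auto elim: dvdE)
    have kr: "k ^ r = m * a + of_nat r * b"
      using a b by (simp add: algebra_simps)
    \<comment> \<open>With \<open>x * pderiv X = n * (X + 1)\<close> and the product rule,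
      \<open>n\<close> becomes congruent to \<open>k * (x * pderiv m)\<close> modulo
      \<open>m\<close>.\<close>
    define x :: "int poly" where "x = monom 1 1"
    have "pderiv X = of_nat n * x ^ (n - 1)"
      unfolding X_def x_def
      by (simp add: pderiv_diff pderiv_monom monom_power of_nat_monom mult_monom)
    moreover have "x * x ^ (n - 1) = X + 1"
      using n unfolding X_def x_def by (simp add: monom_power mult_monom)
    ultimately have "x * pderiv X = of_nat n * (X + 1)"
      by (metis mult.left_commute)
    then have "of_nat n = x * pderiv (m * k) - of_nat n * (m * k)"
      using k by (simp add: algebra_simps)
    then have "of_nat n = m * (x * pderiv k - of_nat n * k) + k * (x * pderiv m)"
      by (simp add: pderiv_mult algebra_simps)
    then have "m dvd of_nat n - k * (x * pderiv m)"
      by (metis add_diff_cancel_right' dvd_triv_left)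
    moreover have "of_nat n - k * (x * pderiv m) dvd of_nat n ^ r - (k * (x * pderiv m)) ^ r"
      by (simp add: power_diff_sumr2)
    ultimately obtain c where c: "of_nat n ^ r - (k * (x * pderiv m)) ^ r = m * c"
      using dvd_trans dvdE by metis
    \<comment> \<open>Substituting \<open>kr\<close> into the \<open>r\<close>-th power of that
      congruence gives \<open>n ^ r = m * d + r * e\<close>; it remains to see that \<open>r\<close>
      divides \<open>d\<close>.\<close>
    define d e where "d = c + a * (x * pderiv m) ^ r" and "e = b * (x * pderiv m) ^ r"
    have nr: "of_nat n ^ r = m * d + of_nat r * e"
      using c unfolding power_mult_distrib kr d_def e_def by (simp add: algebra_simps)
    have d: "[:int r:] dvd d"
    proof -
      \<comment> \<open>Descending induction on \<open>i\<close>: at \<open>degree m + i\<close>,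
        which is positive, the constant \<open>n ^ r\<close> has coefficient 0; modulo
        \<open>r\<close> and the higher coefficients of \<open>d\<close>, only a unit times
        \<open>coeff d i\<close> is left.\<close>
      have "int r dvd coeff d i" for i
      proof (induction "degree d - i" arbitrary: i rule: less_induct)
        case less
        show ?case
        proof (cases "i \<le> degree d")
          case False
          then show ?thesis by (simp add: coeff_eq_0)
        next
          case True
          have IH: "int r dvd coeff d j" if "j > i" for j
            using less[of j] that True by (cases "j \<le> degree d") (auto simp: coeff_eq_0)
          have "coeff (of_nat n ^ r :: int poly) (degree m + i) = 0"
            using \<open>degree m > 0\<close> by (simp add: of_nat_poly poly_const_pow coeff_pCons split: nat.split)
          then have "coeff (m * d) (degree m + i) = - int r * coeff e (degree m + i)"
            unfolding nr by (simp add: of_nat_poly)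
          then have 1: "int r dvd coeff (m * d) (degree m + i)"
            by simp
          have "coeff (m * d) (degree m + i) =
              (\<Sum>j\<le>degree m + i. coeff m j * coeff d (degree m + i - j))"
            by (rule coeff_mult)
          also have "\<dots> = lead_coeff m * coeff d i +
              (\<Sum>j\<in>{..degree m + i} - {degree m}. coeff m j * coeff d (degree m + i - j))"
            by (subst sum.remove[of _ "degree m"]) auto
          finally have 2: "coeff (m * d) (degree m + i) = \<dots>" .
          have "int r dvd (\<Sum>j\<in>{..degree m + i} - {degree m}. coeff m j * coeff d (degree m + i - j))"
          proof (rule dvd_sum)
            fix j assume j: "j \<in> {..degree m + i} - {degree m}"
            show "int r dvd coeff m j * coeff d (degree m + i - j)"
            proof (cases "j < degree m")
              case True
              then show ?thesis using IH[of "degree m + i - j"] by auto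
            next
              case False
              then show ?thesis using j by (auto simp: coeff_eq_0)
            qed
          qed
          with 1 2 have "int r dvd lead_coeff m * coeff d i"
            by (simp add: dvd_add_left_iff)
          moreover have "lead_coeff m = 1 \<or> lead_coeff m = -1"
            using lead by (auto simp: zdvd1_eq)
          ultimately show ?thesis
            by auto
        qed
      qed
      then show ?thesis
        by (simp add: const_poly_dvd_iff)
    qed
    have "[:int r:] dvd of_nat n ^ r"
      unfolding nr by (intro dvd_add dvd_mult[OF d] dvd_mult2) (simp flip: of_nat_poly)
    then have "int r dvd int n ^ r"
      by (simp add: of_nat_poly poly_const_pow)
    then have "r dvd n"
      using r(1) by (metis int_dvd_int_iff of_nat_power prime_dvd_power)
    with r show False by simp
  qed
  obtain h where "g = m * h"
    using mdvd[OF g] by (auto elim: dvdE)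
  then show ?thesis using mr by simp
qed

text \<open>One prime factor of \<open>r\<close> is treated at a time: each intermediate power
  \<open>\<zeta> ^ x\<close> is again an \<open>n\<close>-th root of unity, so the prime case
  applies to it.\<close>

lemma int_eval_root_of_unity_coprime_power:
  fixes \<zeta> :: complex
  assumes "\<zeta> ^ n = 1" "coprime r n" "r > 0" "int_eval g \<zeta> = 0"
  shows "int_eval g (\<zeta> ^ r) = 0"
  using assms(3,2,4)
proof (induction r rule: prime_divisors_induct)
  case (factor s x)
  then have "int_eval g (\<zeta> ^ x) = 0"
    by simp
  moreover have "(\<zeta> ^ x) ^ n = 1"
    by (metis assms(1) mult.commute power_mult power_one)
  moreover have "\<not> s dvd n"
    using factor by (meson coprime_mult_left_iff coprime_absorb_left not_prime_unit)
  ultimately have "int_eval g ((\<zeta> ^ x) ^ s) = 0"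
    using factor(1) int_eval_root_of_unity_prime_power by blast
  then show ?case
    by (simp add: mult.commute flip: power_mult)
qed auto

section \<open>Fourier analysis of periodic functions\<close>

text \<open>Functions on the cyclic group are carried as periodic functions on the integers, so that
  translations need no reduction modulo \<open>M\<close>.\<close>

definition periodic :: "nat \<Rightarrow> (int \<Rightarrow> 'a) \<Rightarrow> bool"
  where "periodic M h \<longleftrightarrow> (\<forall>x. h (x + int M) = h x)"

lemma periodic_add_mult:
  assumes "periodic M h"
  shows "h (x + k * int M) = h x"
proof (induction k rule: int_induct[where k = 0])
  case (step1 i)
  then show ?case
    using assms unfolding periodic_def by (metis add.assoc distrib_right mult_1)
next
  case (step2 i)
  have "h (x + (i - 1) * int M + int M) = h (x + (i - 1) * int M)"
    using assms unfolding periodic_def by blast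
  with step2 show ?case
    by (simp add: algebra_simps)
qed simp

lemma periodic_eqI:
  assumes "periodic M h" "int M dvd x - y"
  shows "h x = h y"
proof -
  obtain k where "x - y = int M * k" using assms(2) by (auto elim: dvdE)
  then have "x = y + k * int M" by (simp add: algebra_simps)
  then show ?thesis using periodic_add_mult[OF assms(1)] by simp
qed

lemma periodic_shift: "periodic M h \<Longrightarrow> periodic M (\<lambda>x. h (x + s))"
  unfolding periodic_def by (metis add.assoc add.commute)

lemma sum_periodic_shift:
  fixes h :: "int \<Rightarrow> 'a::ab_group_add"
  assumes "periodic M h"
  shows "(\<Sum>z<M. h (int z + s)) = (\<Sum>z<M. h (int z))"
proof -
  have step: "(\<Sum>z<M. h (int z + (s + 1))) = (\<Sum>z<M. h (int z + s))" for s
  proof -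
    have "(\<Sum>z<Suc M. h (int z + s)) = h s + (\<Sum>z<M. h (int z + (s + 1)))"
      by (subst sum.lessThan_Suc_shift) (simp add: algebra_simps)
    moreover have "h (int M + s) = h s"
      using assms unfolding periodic_def by (metis add.commute)
    ultimately show ?thesis by (simp add: algebra_simps)
  qed
  show ?thesis
  proof (induction s rule: int_induct[where k = 0])
    case (step2 i)
    then show ?case using step[of "i - 1"] by simp
  qed (use step in auto)
qed

section \<open>Characters, the transform and its inversion\<close>

definition root_pow :: "nat \<Rightarrow> int \<Rightarrow> complex"
  where "root_pow M k = cis (- 2 * pi * of_int k / of_nat M)"

lemma root_pow_0 [simp]: "root_pow M 0 = 1"
  by (simp add: root_pow_def)

lemma root_pow_add: "root_pow M (a + b) = root_pow M a * root_pow M b"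
  by (simp add: root_pow_def cis_mult add_divide_distrib algebra_simps diff_divide_distrib)

lemma root_pow_power: "root_pow M k ^ n = root_pow M (int n * k)"
  by (induction n) (simp_all add: root_pow_add algebra_simps)

lemma root_pow_eq_1_iff:
  assumes "M > 0"
  shows "root_pow M k = 1 \<longleftrightarrow> int M dvd k"
proof
  assume "root_pow M k = 1"
  then have "cos (- 2 * pi * of_int k / of_nat M) = 1"
    unfolding root_pow_def by (metis cis.sel(1) one_complex.sel(1))
  then obtain j :: int where "- 2 * pi * of_int k / of_nat M = of_int j * 2 * pi"
    using cos_one_2pi_int by blast
  then have "pi * (- real_of_int k) = pi * (of_int j * of_nat M)"
    using assms by (simp add: field_simps)
  then have "- real_of_int k = of_int j * of_nat M"
    using pi_neq_zero mult_left_cancel by blast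
  then have "real_of_int (- k) = real_of_int (j * int M)"
    by simp
  then have "- k = j * int M"
    by (simp only: of_int_eq_iff)
  then show "int M dvd k"
    by (metis dvd_minus_iff dvd_triv_right)
next
  assume "int M dvd k"
  then obtain j where "k = int M * j" by (auto elim: dvdE)
  then have "- 2 * pi * of_int k / of_nat M = 2 * pi * of_int (- j)"
    using assms by (simp add: field_simps)
  then show "root_pow M k = 1"
    unfolding root_pow_def by (simp only: cis_multiple_2pi Ints_of_int)
qed

lemma root_pow_cong:
  assumes "M > 0" "int M dvd a - b"
  shows "root_pow M a = root_pow M b"
proof -
  have "root_pow M a = root_pow M (a - b) * root_pow M b"
    by (simp flip: root_pow_add)
  then show ?thesis using root_pow_eq_1_iff[OF assms(1)] assms(2) by simp
qed

text \<open>Geometric series whose ratio is an \<open>n\<close>-th root of unity other than 1.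
  Leaving \<open>n\<close> free covers sums along a fibre as well as full orthogonality.\<close>

lemma sum_root_pow_eq_0:
  assumes "M > 0" "int M dvd int n * k" "\<not> int M dvd k"
  shows "(\<Sum>i<n. root_pow M (int i * k)) = 0"
proof -
  have "(1 - root_pow M k) * (\<Sum>i<n. root_pow M k ^ i) = 1 - root_pow M k ^ n"
    by (simp add: one_diff_power_eq)
  also have "\<dots> = 0"
    using root_pow_eq_1_iff[OF assms(1)] assms(2) by (simp add: root_pow_power)
  finally show ?thesis
    using root_pow_eq_1_iff[OF assms(1)] assms(3) by (simp add: root_pow_power)
qed

text \<open>Frequencies range over all integers, so that their orders can be expressed by
  divisibility.\<close>

definition dft :: "nat \<Rightarrow> (int \<Rightarrow> complex) \<Rightarrow> int \<Rightarrow> complex"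
  where "dft M h \<xi> = (\<Sum>z<M. h (int z) * root_pow M (int z * \<xi>))"

lemma dft_0: "dft M h 0 = (\<Sum>z<M. h (int z))"
  by (simp add: dft_def)

lemma dft_diff: "dft M (\<lambda>x. g x - h x) \<xi> = dft M g \<xi> - dft M h \<xi>"
  by (simp add: dft_def algebra_simps sum_subtractf)

lemma dft_sum: "dft M (\<lambda>x. \<Sum>i\<in>I. h i x) \<xi> = (\<Sum>i\<in>I. dft M (h i) \<xi>)"
  unfolding dft_def sum_distrib_right by (rule sum.swap)

lemma dft_shift:
  assumes "M > 0" "periodic M h"
  shows "dft M (\<lambda>x. h (x + s)) \<xi> = root_pow M (- s * \<xi>) * dft M h \<xi>"
proof -
  have "periodic M (\<lambda>x. h x * root_pow M (x * \<xi>))"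
    using assms unfolding periodic_def
    by (auto intro!: arg_cong2[where f = times] root_pow_cong simp: algebra_simps)
  from sum_periodic_shift[OF this, of s]
  have "dft M h \<xi> = (\<Sum>z<M. h (int z + s) * root_pow M ((int z + s) * \<xi>))"
    unfolding dft_def by simp
  also have "\<dots> = root_pow M (s * \<xi>) * dft M (\<lambda>x. h (x + s)) \<xi>"
    unfolding dft_def sum_distrib_left
    by (intro sum.cong) (simp_all add: root_pow_add distrib_right)
  finally have "root_pow M (- s * \<xi>) * dft M h \<xi> =
      root_pow M (- s * \<xi> + s * \<xi>) * dft M (\<lambda>x. h (x + s)) \<xi>"
    by (simp only: root_pow_add[of M "- s * \<xi>" "s * \<xi>"] mult.assoc)
  then show ?thesis by simp
qed

lemma sum_dft:
  assumes "M > 0"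
  shows "(\<Sum>\<xi><M. dft M h (int \<xi>)) = of_nat M * h 0"
proof -
  have "(\<Sum>\<xi><M. dft M h (int \<xi>)) = (\<Sum>z<M. h (int z) * (\<Sum>\<xi><M. root_pow M (int \<xi> * int z)))"
    unfolding dft_def sum_distrib_left by (subst sum.swap) (simp add: mult.commute)
  also have "\<dots> = (\<Sum>z<M. if z = 0 then h 0 * of_nat M else 0)"
  proof (rule sum.cong)
    fix z assume "z \<in> {..<M}"
    then have "z = 0 \<or> \<not> int M dvd int z"
      by (auto dest: nat_dvd_not_less)
    then show "h (int z) * (\<Sum>\<xi><M. root_pow M (int \<xi> * int z)) = (if z = 0 then h 0 * of_nat M else 0)"
      using sum_root_pow_eq_0[OF assms, of M "int z"] by auto
  qed simp
  finally show ?thesis using assms by (simp add: mult.commute)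
qed

text \<open>Inversion at the origin, applied to the translate by \<open>x\<close>: only frequency 0
  contributes, and there translation does not change the transform.\<close>

lemma dft_concentrated_imp_const:
  assumes "M > 0" "periodic M h" "\<And>\<xi>. \<not> int M dvd \<xi> \<Longrightarrow> dft M h \<xi> = 0"
  shows "of_nat M * h x = dft M h 0"
proof -
  have "of_nat M * h x = (\<Sum>\<xi><M. dft M (\<lambda>y. h (y + x)) (int \<xi>))"
    using sum_dft[OF assms(1), of "\<lambda>y. h (y + x)"] by simp
  also have "\<dots> = (\<Sum>\<xi><M. if \<xi> = 0 then dft M h 0 else 0)"
  proof (rule sum.cong)
    fix \<xi> assume "\<xi> \<in> {..<M}"
    then have "\<xi> = 0 \<or> \<not> int M dvd int \<xi>"
      by (auto dest: nat_dvd_not_less)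
    then show "dft M (\<lambda>y. h (y + x)) (int \<xi>) = (if \<xi> = 0 then dft M h 0 else 0)"
      using assms(3) by (auto simp: dft_shift[OF assms(1,2)])
  qed simp
  finally show ?thesis using assms(1) by simp
qed

lemma dft_convolution:
  assumes "M > 0" "periodic M h"
  shows "dft M (\<lambda>x. \<Sum>y<M. h (x - int y) * f (int y)) \<xi> = dft M h \<xi> * dft M f \<xi>"
proof -
  have "dft M (\<lambda>x. h (x - int y) * f (int y)) \<xi> = dft M h \<xi> * (f (int y) * root_pow M (int y * \<xi>))" for y
  proof -
    have "dft M (\<lambda>x. h (x - int y) * f (int y)) \<xi> = dft M (\<lambda>x. h (x + - int y)) \<xi> * f (int y)"
      unfolding dft_def sum_distrib_right by (simp add: algebra_simps)
    then show ?thesis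
      unfolding dft_shift[OF assms] by (simp add: algebra_simps)
  qed
  then show ?thesis
    unfolding dft_sum dft_def[of M f] sum_distrib_left by simp
qed

section \<open>Structure forced by zeros of the transform\<close>

text \<open>Summing over translates by multiples of \<open>p\<close> kills every frequency not
  divisible by \<open>q\<close>; the hypothesis kills the other nonzero ones, so the fibre sum is
  constant.\<close>

lemma fibre_sum_const:
  assumes "p > 0" "q > 0" "periodic (p * q) h"
    and zero: "\<And>\<xi>. int q dvd \<xi> \<Longrightarrow> \<not> int (p * q) dvd \<xi> \<Longrightarrow> dft (p * q) h \<xi> = 0"
  shows "of_nat p * (\<Sum>i<q. h (x + int i * int p)) = (\<Sum>z<p * q. h (int z))"
proof -
  define M where "M = p * q"
  have M: "M > 0" and per: "periodic M h"
    using assms by (simp_all add: M_def)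
  define S where "S = (\<lambda>x. \<Sum>i<q. h (x + int i * int p))"
  have "periodic M S"
    unfolding periodic_def S_def
    using periodic_shift[OF per] by (auto simp: periodic_def intro!: sum.cong)
  moreover have "dft M S \<xi> = 0" if "\<not> int M dvd \<xi>" for \<xi>
  proof (cases "int q dvd \<xi>")
    case True
    then show ?thesis
      unfolding S_def dft_sum dft_shift[OF M per] using zero that by (simp add: M_def)
  next
    case False
    have "(\<Sum>i<q. root_pow M (int i * (- int p * \<xi>))) = 0"
      using False assms(1) by (intro sum_root_pow_eq_0[OF M]) (auto simp: M_def)
    then show ?thesis
      unfolding S_def dft_sum dft_shift[OF M per] sum_distrib_right[symmetric]
      by (simp add: mult.assoc)
  qed
  ultimately have "of_nat M * S x = dft M S 0"
    by (rule dft_concentrated_imp_const[OF M])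
  also have "\<dots> = of_nat q * (\<Sum>z<M. h (int z))"
    unfolding S_def dft_sum dft_0 sum_periodic_shift[OF per] by simp
  finally show ?thesis
    using assms(2) by (simp add: M_def S_def algebra_simps)
qed

lemma dft_zero_imp_zero:
  assumes "M > 0" "periodic M h" "\<And>\<xi>. dft M h \<xi> = 0"
  shows "h x = 0"
  using dft_concentrated_imp_const[OF assms(1,2), of x] assms by simp

text \<open>Translation by \<open>p\<close> multiplies the transform by a factor equal to 1 at
  multiples of \<open>q\<close>, and elsewhere the transform vanishes.\<close>

lemma dft_zero_imp_shift_invariant:
  assumes "p > 0" "q > 0" "periodic (p * q) h"
    and zero: "\<And>\<xi>. \<not> int q dvd \<xi> \<Longrightarrow> dft (p * q) h \<xi> = 0"
  shows "h (x + int p) = h x"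
proof -
  have M: "p * q > 0" using assms by simp
  have "periodic (p * q) (\<lambda>x. h (x + int p) - h x)"
    using assms(3) periodic_shift[OF assms(3)] by (simp add: periodic_def)
  moreover have "dft (p * q) (\<lambda>x. h (x + int p) - h x) \<xi> = 0" for \<xi>
  proof (cases "int q dvd \<xi>")
    case True
    then have "root_pow (p * q) (- int p * \<xi>) = 1"
      unfolding root_pow_eq_1_iff[OF M] by simp
    then show ?thesis
      by (simp add: dft_diff dft_shift[OF M assms(3)])
  next
    case False
    then show ?thesis
      by (simp add: dft_diff dft_shift[OF M assms(3)] zero)
  qed
  ultimately have "h (x + int p) - h x = 0"
    by (rule dft_zero_imp_zero[OF M])
  then show ?thesis by simp
qed

text \<open>The two differences contribute factors vanishing at multiples of \<open>q\<close> and of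
  \<open>p\<close>. The conclusion encodes that \<open>h\<close> is a function modulo
  \<open>p\<close> plus one modulo \<open>q\<close>.\<close>

lemma dft_zero_imp_second_difference:
  assumes "p > 0" "q > 0" "periodic (p * q) h"
    and zero: "\<And>\<xi>. \<not> int p dvd \<xi> \<Longrightarrow> \<not> int q dvd \<xi> \<Longrightarrow> dft (p * q) h \<xi> = 0"
  shows "h (x + i * int p + j * int q) - h (x + i * int p) = h (x + j * int q) - h x"
proof -
  have M: "p * q > 0" using assms by simp
  define g where "g = (\<lambda>x. h (x + i * int p) - h x)"
  have g: "periodic (p * q) g"
    unfolding g_def using assms(3) periodic_shift[OF assms(3)] by (simp add: periodic_def)
  have dg: "dft (p * q) g \<xi> = (root_pow (p * q) (- (i * int p) * \<xi>) - 1) * dft (p * q) h \<xi>" for \<xi>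
    unfolding g_def by (simp add: dft_diff dft_shift[OF M assms(3)] algebra_simps)
  have "periodic (p * q) (\<lambda>x. g (x + j * int q) - g x)"
    using g periodic_shift[OF g] by (simp add: periodic_def)
  moreover have "dft (p * q) (\<lambda>x. g (x + j * int q) - g x) \<xi> = 0" for \<xi>
  proof -
    have "root_pow (p * q) (- (i * int p) * \<xi>) = 1" if "int q dvd \<xi>"
      unfolding root_pow_eq_1_iff[OF M] using that by (simp add: mult.assoc mult_dvd_mono)
    moreover have "root_pow (p * q) (- (j * int q) * \<xi>) = 1" if "int p dvd \<xi>"
      unfolding root_pow_eq_1_iff[OF M] using that
      by (auto simp: mult.assoc mult.commute[of "int p"] mult_dvd_mono)
    ultimately show ?thesis
      unfolding dft_diff dft_shift[OF M g] dg using zero[of \<xi>] by auto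
  qed
  ultimately have "g (x + j * int q) - g x = 0"
    by (rule dft_zero_imp_zero[OF M])
  then show ?thesis by (simp add: g_def algebra_simps)
qed

section \<open>Galois conjugate frequencies\<close>

lemma dft_of_int:
  "dft M (\<lambda>x. of_int (c x)) \<xi> = int_eval (\<Sum>z<M. monom (c (int z)) z) (root_pow M \<xi>)"
  by (simp add: dft_def int_eval_sum root_pow_power)

text \<open>The transform evaluates one fixed integer polynomial at roots of unity, and
  \<open>root_pow M d\<close> is an \<open>n\<close>-th one. Multiplying the frequency by
  \<open>\<xi>\<close> raises it to a power coprime to \<open>n\<close>, which preserves
  zeros.\<close>

lemma dft_of_int_galois:
  assumes M: "M = d * n" "M > 0" and "coprime \<xi> (int n)"
  shows "dft M (\<lambda>x. of_int (c x)) (int d * \<xi>) = 0 \<longleftrightarrow> dft M (\<lambda>x. of_int (c x)) (int d) = 0"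
proof -
  define D where "D = dft M (\<lambda>x. of_int (c x))"
  have D_cong: "D a = D b" if "int M dvd a - b" for a b
    unfolding D_def dft_of_int root_pow_cong[OF M(2) that] ..
  have key: "D (int d * a * \<eta>) = 0" if "coprime \<eta> (int n)" "D (int d * a) = 0" for a \<eta>
  proof -
    \<comment> \<open>The added \<open>n\<close> keeps the exponent positive even when the residue
      is 0, as for \<open>n = 1\<close>.\<close>
    define r where "r = nat (\<eta> mod int n) + n"
    have n: "n > 0" using M by auto
    have r: "int r = \<eta> mod int n + int n"
      using n by (simp add: r_def)
    have "coprime (int r) (int n)"
    proof -
      have mod: "int r mod int n = \<eta> mod int n" unfolding r by simp
      have "coprime (\<eta> mod int n) (int n)"
        using that(1) n by (subst coprime_mod_left_iff) simp_all
      then have "coprime (int r mod int n) (int n)"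
        by (simp only: mod)
      then show ?thesis
        using n by (subst (asm) coprime_mod_left_iff) simp_all
    qed
    then have "coprime r n" by simp
    have "int n dvd (\<eta> - \<eta> mod int n) - int n"
      by (rule dvd_diff[OF dvd_minus_mod dvd_refl])
    then have "int n dvd \<eta> - int r"
      by (simp add: r diff_diff_eq)
    then have "int d * int n dvd int d * (a * (\<eta> - int r))"
      by (intro mult_dvd_mono dvd_mult) simp_all
    also have "int d * (a * (\<eta> - int r)) = int d * a * \<eta> - int r * (int d * a)"
      by (simp add: algebra_simps)
    finally have "int M dvd int d * a * \<eta> - int r * (int d * a)"
      by (simp add: M(1))
    then have "D (int d * a * \<eta>) = D (int r * (int d * a))"
      by (rule D_cong)
    also have "\<dots> = int_eval (\<Sum>z<M. monom (c (int z)) z) (root_pow M (int d * a) ^ r)"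
      unfolding D_def dft_of_int root_pow_power ..
    also have "\<dots> = 0"
    proof (rule int_eval_root_of_unity_coprime_power[of _ n])
      show "root_pow M (int d * a) ^ n = 1"
        unfolding root_pow_power root_pow_eq_1_iff[OF M(2)] by (simp add: M(1))
      show "r > 0" using n by (simp add: r_def)
    qed (use \<open>coprime r n\<close> that(2) in \<open>auto simp: D_def dft_of_int\<close>)
    finally show ?thesis .
  qed
  \<comment> \<open>The inverse \<open>u\<close> of \<open>\<xi>\<close> modulo \<open>n\<close>
    leads back from \<open>d * \<xi>\<close> to \<open>d\<close>, giving the converse.\<close>
  obtain u v where uv: "u * \<xi> + v * int n = 1"
    using bezout_int[of \<xi> "int n"] assms(3) by auto
  have "coprime u (int n)"
  proof (rule coprimeI)
    fix k assume "k dvd u" "k dvd int n"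
    then have "k dvd u * \<xi> + v * int n" by (intro dvd_add dvd_mult dvd_mult2)
    then show "k dvd 1" by (simp add: uv)
  qed
  have "int d * \<xi> * u - int d = int d * (u * \<xi> + v * int n) - int d - v * int M"
    by (simp add: M(1) algebra_simps)
  then have "int d * \<xi> * u - int d = - (v * int M)"
    by (simp add: uv)
  then have "D (int d * \<xi> * u) = D (int d)"
    by (intro D_cong) simp
  then have "D (int d * \<xi>) = 0 \<longleftrightarrow> D (int d) = 0"
    using key[OF \<open>coprime u (int n)\<close>, of \<xi>] key[OF assms(3), of 1] by auto
  then show ?thesis unfolding D_def .
qed

section \<open>Residue indicators and tilings\<close>

text \<open>The codomain is left open: real values serve the tiling identity, complex ones the
  transform, integer ones the Galois argument.\<close>

definition residue_indicator :: "nat \<Rightarrow> int set \<Rightarrow> int \<Rightarrow> 'a::zero_neq_one"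
  where "residue_indicator M A x = of_bool (x mod int M \<in> A)"

lemma periodic_residue_indicator: "periodic M (residue_indicator M A)"
  by (simp add: periodic_def residue_indicator_def)

lemma sum_residue_indicator:
  assumes "A \<subseteq> {0..<int M}"
  shows "(\<Sum>z<M. residue_indicator M A (int z)) = (of_nat (card A) :: 'a::semiring_char_0)"
proof -
  have "int ` {z. z < M \<and> int z \<in> A} = A"
  proof
    show "A \<subseteq> int ` {z. z < M \<and> int z \<in> A}"
    proof
      fix a assume "a \<in> A"
      then show "a \<in> int ` {z. z < M \<and> int z \<in> A}"
        using assms by (intro image_eqI[of _ _ "nat a"]) auto
    qed
  qed auto
  then have "card A = card {z. z < M \<and> int z \<in> A}"
    using card_image[of int "{z. z < M \<and> int z \<in> A}"] by simp
  moreover have "{z. z < M \<and> int z \<in> A} = {..<M} \<inter> {z. int z \<in> A}"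
    by auto
  ultimately have "card A = card ({..<M} \<inter> {z. int z \<in> A})"
    by (simp only:)
  then show ?thesis
    by (simp add: residue_indicator_def sum_of_bool_eq)
qed

lemma dft_residue_indicator_galois:
  assumes "M = d * n" "M > 0" "coprime \<xi> (int n)"
  shows "dft M (residue_indicator M A) (int d * \<xi>) = 0 \<longleftrightarrow> dft M (residue_indicator M A) (int d) = 0"
proof -
  have "residue_indicator M A = (\<lambda>x. complex_of_int (residue_indicator M A x))"
    by (simp add: residue_indicator_def fun_eq_iff)
  then show ?thesis
    using dft_of_int_galois[OF assms] by metis
qed

text \<open>Once \<open>b\<close> is known its partner must be \<open>(x - b) mod M\<close>, so only
  \<open>b\<close> has to be unique.\<close>

lemma translational_tileI:
  assumes "M > 0" "A \<subseteq> {0..<int M}" "B \<subseteq> {0..<int M}"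
    and "\<And>x. \<exists>!b. b \<in> B \<and> (x - b) mod int M \<in> A"
  shows "translational_tile M A"
proof -
  have "\<exists>!ab. ab \<in> A \<times> B \<and> x = (fst ab + snd ab) mod int M" if x: "x \<in> {0..<int M}" for x
  proof -
    obtain b where b: "b \<in> B" "(x - b) mod int M \<in> A"
      and uniq: "\<And>b'. b' \<in> B \<Longrightarrow> (x - b') mod int M \<in> A \<Longrightarrow> b' = b"
      using assms(4)[of x] by blast
    show ?thesis
    proof (rule ex1I[of _ "((x - b) mod int M, b)"])
      show "((x - b) mod int M, b) \<in> A \<times> B \<and>
          x = (fst ((x - b) mod int M, b) + snd ((x - b) mod int M, b)) mod int M"
        using b x by (simp add: mod_add_left_eq)
    next
      fix ab assume ab: "ab \<in> A \<times> B \<and> x = (fst ab + snd ab) mod int M"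
      then have "fst ab \<in> {0..<int M}"
        using assms(2) by auto
      then have "(x - snd ab) mod int M = fst ab"
        using ab by (simp add: mod_diff_left_eq)
      moreover have "snd ab = b"
        using uniq[of "snd ab"] ab calculation by (auto simp: mem_Times_iff)
      ultimately show "ab = ((x - b) mod int M, b)"
        by (simp add: prod_eq_iff)
    qed
  qed
  then have "direct_sum_cyclic M A B"
    using assms(1-3) by (simp add: direct_sum_cyclic_def carrier_integer_mod_group)
  then show ?thesis
    using assms(1,3) by (auto simp: translational_tile_def carrier_integer_mod_group)
qed

lemma translational_tile_whole:
  assumes "M > 0"
  shows "translational_tile M {0..<int M}"
  by (rule translational_tileI[of _ _ "{0}"]) (use assms in auto)

lemma translational_tile_singleton:
  assumes "M > 0" "a \<in> {0..<int M}"
  shows "translational_tile M {a}"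
proof (rule translational_tileI[of _ _ "{0..<int M}"])
  show "\<exists>!b. b \<in> {0..<int M} \<and> (x - b) mod int M \<in> {a}" for x
  proof (rule ex1I[of _ "(x - a) mod int M"])
    show "(x - a) mod int M \<in> {0..<int M} \<and> (x - (x - a) mod int M) mod int M \<in> {a}"
      using assms by (simp add: mod_diff_right_eq)
  next
    fix b assume b: "b \<in> {0..<int M} \<and> (x - b) mod int M \<in> {a}"
    then have a: "a = (x - b) mod int M" by simp
    have "b \<in> {0..<int M}" using b by simp
    then have "(x - (x - b) mod int M) mod int M = b"
      by (simp add: mod_diff_right_eq)
    then show "b = (x - a) mod int M"
      unfolding a[symmetric] by simp
  qed
qed (use assms in auto)

lemma inj_on_fibre:
  assumes "p > 0"
  shows "inj_on (\<lambda>i. (x + int i * int p) mod int (p * q)) {..<q}"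
proof (rule inj_onI)
  fix i j assume ij: "i \<in> {..<q}" "j \<in> {..<q}"
    and eq: "(x + int i * int p) mod int (p * q) = (x + int j * int p) mod int (p * q)"
  then have "int (p * q) dvd (x + int i * int p) - (x + int j * int p)"
    by (simp add: mod_eq_dvd_iff)
  then have "int p * int q dvd int p * (int i - int j)"
    by (simp add: algebra_simps)
  then have "int q dvd int i - int j"
    using assms by simp
  then have "int i mod int q = int j mod int q"
    by (simp add: mod_eq_dvd_iff)
  then show "i = j" using ij by simp
qed

section \<open>Weak tilings\<close>

definition weak_tiling :: "nat \<Rightarrow> int set \<Rightarrow> (int \<Rightarrow> real) \<Rightarrow> bool"
  where "weak_tiling M A f \<longleftrightarrow> A \<subseteq> {0..<int M} \<and> periodic M f \<and> f 0 = 1 \<and> (\<forall>x. f x \<ge> 0) \<and>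
    (\<forall>x. (\<Sum>y<M. residue_indicator M A (x - int y) * f (int y)) = 1)"

lemma weak_tiling_dft:
  assumes "weak_tiling M A f" "M > 0"
  shows "dft M (residue_indicator M A) \<xi> * dft M (\<lambda>x. of_real (f x)) \<xi> = dft M (\<lambda>_. 1) \<xi>"
proof -
  have "(\<Sum>y<M. residue_indicator M A (x - int y) * complex_of_real (f (int y))) = 1" for x
  proof -
    have "complex_of_real (\<Sum>y<M. residue_indicator M A (x - int y) * f (int y)) = of_real 1"
      using assms unfolding weak_tiling_def by metis
    then show ?thesis
      by (simp add: residue_indicator_def)
  qed
  then show ?thesis
    unfolding dft_convolution[OF assms(2) periodic_residue_indicator, symmetric] by simp
qed

lemma weak_tiling_dft_zero:
  assumes "weak_tiling M A f" "M > 0" "\<not> int M dvd \<xi>"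
  shows "dft M (residue_indicator M A) \<xi> = 0 \<or> dft M (\<lambda>x. of_real (f x)) \<xi> = 0"
proof -
  have "dft M (\<lambda>_. 1) \<xi> = 0"
    using sum_root_pow_eq_0[OF assms(2) _ assms(3), of M] by (simp add: dft_def)
  then show ?thesis
    using weak_tiling_dft[OF assms(1,2), of \<xi>] by simp
qed

text \<open>The transform identity at frequency 0.\<close>

lemma weak_tiling_card:
  assumes "weak_tiling M A f" "M > 0"
  shows "real (card A) * (\<Sum>y<M. f (int y)) = real M"
proof -
  have A: "A \<subseteq> {0..<int M}" using assms by (simp add: weak_tiling_def)
  have "complex_of_real (real (card A) * (\<Sum>y<M. f (int y))) = of_real (real M)"
    using weak_tiling_dft[OF assms, of 0] by (simp add: dft_0 sum_residue_indicator[OF A])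
  then show ?thesis by (simp only: of_real_eq_iff)
qed

lemma weak_tiling_card_pos:
  assumes "weak_tiling M A f" "M > 0"
  shows "card A > 0"
  using weak_tiling_card[OF assms] assms(2) by (cases "card A") auto

lemma translational_tile_if_full_card:
  assumes "weak_tiling M A f" "M > 0" "M \<le> card A"
  shows "translational_tile M A"
proof -
  have "A = {0..<int M}"
    by (rule card_subset_eq) (use assms card_mono[of "{0..<int M}" A] in \<open>auto simp: weak_tiling_def\<close>)
  then show ?thesis using translational_tile_whole assms(2) by simp
qed

text \<open>Equidistribution of \<open>A\<close> modulo \<open>p\<close>: the progression in
  \<open>i\<close> runs once through the residue class of \<open>x\<close> modulo
  \<open>p\<close>.\<close>

lemma weak_tiling_fibre_card:
  assumes "weak_tiling (p * q) A f" "p > 0" "q > 0"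
    and zero: "\<And>\<xi>. int q dvd \<xi> \<Longrightarrow> \<not> int (p * q) dvd \<xi> \<Longrightarrow> dft (p * q) (residue_indicator (p * q) A) \<xi> = 0"
  shows "p * card {i. i < q \<and> (x + int i * int p) mod int (p * q) \<in> A} = card A"
proof -
  have A: "A \<subseteq> {0..<int (p * q)}" using assms by (simp add: weak_tiling_def)
  have "{i. i < q \<and> (x + int i * int p) mod int (p * q) \<in> A} =
      {..<q} \<inter> {i. (x + int i * int p) mod int (p * q) \<in> A}"
    by auto
  then have "complex_of_nat (p * card {i. i < q \<and> (x + int i * int p) mod int (p * q) \<in> A}) =
      of_nat p * (\<Sum>i<q. residue_indicator (p * q) A (x + int i * int p))"
    unfolding residue_indicator_def by (simp only: sum_of_bool_eq of_nat_mult) simp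
  also have "\<dots> = of_nat (card A)"
    unfolding sum_residue_indicator[OF A, symmetric]
    by (rule fibre_sum_const[OF assms(2,3) periodic_residue_indicator]) (rule zero)
  finally show ?thesis by (simp only: of_nat_eq_iff)
qed

section \<open>Tiling criteria\<close>

lemma translational_tile_if_shift_invariant:
  assumes wt: "weak_tiling (p * q) A f" and "prime p" "q > 0"
    and inv: "\<And>x. residue_indicator (p * q) A (x + int p) = (residue_indicator (p * q) A x :: nat)"
  shows "translational_tile (p * q) A"
proof -
  define M where "M = p * q"
  have p: "p > 0" using assms(2) by (rule prime_gt_0_nat)
  have M: "M > 0" using p assms(3) by (simp add: M_def)
  have A: "A \<subseteq> {0..<int M}" using wt by (simp add: weak_tiling_def M_def)
  have "periodic p (\<lambda>x. x mod int M \<in> A)"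
    using inv by (auto simp: periodic_def residue_indicator_def M_def of_bool_eq_iff)
  then have mem: "x mod int M \<in> A \<longleftrightarrow> y mod int M \<in> A" if "int p dvd x - y" for x y
    using that by (rule periodic_eqI)
  obtain a where a: "a \<in> A"
    using weak_tiling_card_pos[OF wt] M by (auto simp: M_def card_gt_0_iff)
  then have a': "a mod int M \<in> A"
    using A by (metis atLeastLessThan_iff mod_pos_pos_trivial subsetD)
  have fibre: "(a + int i * int p) mod int M \<in> A" for i
    using mem[of "a + int i * int p" a] a' by simp
  \<comment> \<open>These frequencies all have order \<open>p\<close>, so the transform of
    \<open>A\<close> vanishes at all of them or at none; in the latter case that of \<open>f\<close>
    vanishes at all.\<close>
  have galois: "dft M (residue_indicator M A) \<xi> = 0 \<longleftrightarrow> dft M (residue_indicator M A) (int q) = 0"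
    if "int q dvd \<xi>" "\<not> int M dvd \<xi>" for \<xi>
  proof -
    from that(1) obtain \<eta> where \<eta>: "\<xi> = int q * \<eta>" by (auto elim: dvdE)
    have "coprime (int p) \<eta>"
      using assms(2) that(2) unfolding \<eta> M_def
      by (intro prime_imp_coprime) (auto simp: mult.commute)
    then show ?thesis
      unfolding \<eta> using M by (intro dft_residue_indicator_galois[of _ _ p]) (auto simp: M_def coprime_commute)
  qed
  show ?thesis
  proof (cases "dft M (residue_indicator M A) (int q) = 0")
    case True
    have "p * card {i. i < q \<and> (a + int i * int p) mod int (p * q) \<in> A} = card A"
      using galois True by (intro weak_tiling_fibre_card[OF wt p assms(3)]) (auto simp: M_def)
    then have "card A = M"
      using fibre by (simp add: M_def)
    then show ?thesis
      using translational_tile_if_full_card[OF wt] M by (simp add: M_def)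
  next
    case False
    have "periodic M f" using wt by (simp add: weak_tiling_def M_def)
    then have "periodic M (\<lambda>x. complex_of_real (f x))" by (simp add: periodic_def)
    then have "of_nat p * (\<Sum>i<q. complex_of_real (f (0 + int i * int p))) =
        (\<Sum>z<M. complex_of_real (f (int z)))"
      unfolding M_def
      using galois False weak_tiling_dft_zero[OF wt] M
      by (intro fibre_sum_const[OF p assms(3)]) (auto simp: M_def)
    then have "complex_of_real (of_nat p * (\<Sum>i<q. f (int i * int p))) = of_real (\<Sum>z<M. f (int z))"
      by simp
    then have "of_nat p * (\<Sum>i<q. f (int i * int p)) = (\<Sum>z<M. f (int z))"
      by (simp only: of_real_eq_iff)
    \<comment> \<open>The fibre through 0 contains the value \<open>f 0 = 1\<close>, which bounds
      the common fibre sum from below.\<close>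
    moreover have "f (int 0 * int p) \<le> (\<Sum>i<q. f (int i * int p))"
      using wt assms(3) by (intro member_le_sum) (auto simp: weak_tiling_def)
    then have "1 \<le> (\<Sum>i<q. f (int i * int p))"
      using wt by (simp add: weak_tiling_def)
    ultimately have "real p \<le> (\<Sum>z<M. f (int z))"
      using mult_left_mono[of 1 "\<Sum>i<q. f (int i * int p)" "real p"] by simp
    then have "real (card A) * real p \<le> real (card A) * (\<Sum>z<M. f (int z))"
      by (rule mult_left_mono) simp
    also have "\<dots> = real M"
      unfolding M_def using M by (intro weak_tiling_card[OF wt]) (simp add: M_def)
    finally have "real (card A) * real p \<le> real M" .
    then have "real (card A * p) \<le> real (q * p)"
      by (simp add: M_def mult.commute)
    then have "card A \<le> q"
      using p by (simp only: of_nat_le_iff mult_le_cancel2)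
    \<comment> \<open>\<open>C\<close> is the fibre through \<open>a\<close>; its \<open>q\<close>
      elements already exhaust \<open>A\<close>.\<close>
    define C where "C = (\<lambda>i. (a + int i * int p) mod int M) ` {..<q}"
    have "C \<subseteq> A" using fibre by (auto simp: C_def)
    moreover have "card C = q"
      using card_image[OF inj_on_fibre[OF p, of a q]] by (simp add: C_def M_def)
    moreover have "finite A" using A finite_subset by blast
    ultimately have "C = A"
      using \<open>card A \<le> q\<close> by (intro card_seteq) simp_all
    have A_iff: "x mod int M \<in> A \<longleftrightarrow> int p dvd x - a" for x
    proof
      assume "x mod int M \<in> A"
      then have "x mod int M \<in> C" by (simp only: \<open>C = A\<close>)
      then obtain i where "x mod int M = (a + int i * int p) mod int M"
        unfolding C_def by blast
      then have "int M dvd x - (a + int i * int p)"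
        by (simp add: mod_eq_dvd_iff)
      then have "int p dvd x - (a + int i * int p)"
        using dvd_trans[of "int p" "int M"] by (simp add: M_def)
      then have "int p dvd (x - (a + int i * int p)) + int i * int p"
        by (intro dvd_add) auto
      then show "int p dvd x - a" by simp
    next
      assume "int p dvd x - a"
      then show "x mod int M \<in> A" using mem[of x a] a' by simp
    qed
    show ?thesis
      unfolding M_def[symmetric]
    proof (rule translational_tileI[OF M A, of "{0..<int p}"])
      show "{0..<int p} \<subseteq> {0..<int M}"
      proof -
        have "p \<le> M" using assms(3) by (simp add: M_def)
        then show ?thesis by auto
      qed
      show "\<exists>!b. b \<in> {0..<int p} \<and> (x - b) mod int M \<in> A" for x
      proof (rule ex1I[of _ "(x - a) mod int p"])
        show "(x - a) mod int p \<in> {0..<int p} \<and> (x - (x - a) mod int p) mod int M \<in> A"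
          unfolding A_iff using p by (simp add: mod_eq_dvd_iff[symmetric] mod_diff_right_eq)
      next
        fix b assume b: "b \<in> {0..<int p} \<and> (x - b) mod int M \<in> A"
        then have "int p dvd (x - a) - b"
          unfolding A_iff by (simp add: algebra_simps)
        then have "(x - a) mod int p = b mod int p"
          by (simp add: mod_eq_dvd_iff)
        with b show "b = (x - a) mod int p" by simp
      qed
    qed
  qed
qed

text \<open>Invariance gives \<open>f\<close> the value 1 at all multiples of \<open>p\<close>, so
  its mass is at least \<open>q\<close> and \<open>card A \<le> p\<close>. Equidistribution then
  leaves exactly one point of \<open>A\<close> in each class modulo \<open>p\<close>.\<close>

lemma translational_tile_if_transversal:
  assumes wt: "weak_tiling (p * q) A f" and p: "p > 0" and q: "q > 0"
    and zero: "\<And>\<xi>. int q dvd \<xi> \<Longrightarrow> \<not> int (p * q) dvd \<xi> \<Longrightarrow> dft (p * q) (residue_indicator (p * q) A) \<xi> = 0"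
    and inv: "\<And>x. f (x + int p) = f x"
  shows "translational_tile (p * q) A"
proof -
  define M where "M = p * q"
  have M: "M > 0" using p q by (simp add: M_def)
  have A: "A \<subseteq> {0..<int M}" using wt by (simp add: weak_tiling_def M_def)
  have "periodic p f" using inv by (simp add: periodic_def)
  then have f1: "f (int (i * p)) = 1" for i
    using periodic_eqI[of p f "int (i * p)" 0] wt by (simp add: weak_tiling_def)
  have "real q = (\<Sum>i<q. f (int (i * p)))"
    by (simp only: f1) simp
  also have "\<dots> = (\<Sum>z\<in>(\<lambda>i. i * p) ` {..<q}. f (int z))"
    using p by (subst sum.reindex) (auto simp: inj_on_def)
  also have "\<dots> \<le> (\<Sum>z<M. f (int z))"
    using wt p by (intro sum_mono2) (auto simp: M_def weak_tiling_def mult.commute)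
  finally have "real (card A) * real q \<le> real (card A) * (\<Sum>z<M. f (int z))"
    by (rule mult_left_mono) simp
  also have "\<dots> = real M"
    unfolding M_def using M by (intro weak_tiling_card[OF wt]) (simp add: M_def)
  finally have "real (card A) * real q \<le> real M" .
  then have "real (card A * q) \<le> real (p * q)"
    by (simp add: M_def)
  then have "card A \<le> p"
    using q by (simp only: of_nat_le_iff mult_le_cancel2)
  define I where "I x = {i. i < q \<and> (x + int i * int p) mod int M \<in> A}" for x
  have cardI: "p * card (I x) = card A" for x
    unfolding I_def M_def by (rule weak_tiling_fibre_card[OF wt p q]) (rule zero)
  then have "card (I x) = 1" for x
  proof -
    have "p * card (I x) \<le> p * 1" and "p * card (I x) > 0"
      using cardI[of x] \<open>card A \<le> p\<close> weak_tiling_card_pos[OF wt] M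
      by (simp_all add: M_def)
    then show ?thesis using p by simp
  qed
  then have "\<forall>x. \<exists>i. I x = {i}"
    by (simp add: card_1_singleton_iff)
  then obtain \<iota> where \<iota>: "\<And>x. I x = {\<iota> x}"
    by metis
  \<comment> \<open>The complement is the subgroup of multiples of \<open>p\<close>; the sign makes
    \<open>x - b\<close> run through \<open>x + i * p\<close>.\<close>
  define B where "B = (\<lambda>i. (- (int i * int p)) mod int M) ` {..<q}"
  show ?thesis
    unfolding M_def[symmetric]
  proof (rule translational_tileI[OF M A, of B])
    show "B \<subseteq> {0..<int M}" using M by (auto simp: B_def)
    show "\<exists>!b. b \<in> B \<and> (x - b) mod int M \<in> A" for x
    proof (rule ex1I[of _ "(- (int (\<iota> x) * int p)) mod int M"])
      have "\<iota> x \<in> I x" using \<iota> by simp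
      then have "\<iota> x < q" "(x - - (int (\<iota> x) * int p)) mod int M \<in> A"
        by (simp_all add: I_def)
      then show "(- (int (\<iota> x) * int p)) mod int M \<in> B \<and> (x - (- (int (\<iota> x) * int p)) mod int M) mod int M \<in> A"
        unfolding B_def mod_diff_right_eq by blast
    next
      fix b assume b: "b \<in> B \<and> (x - b) mod int M \<in> A"
      then obtain i where i: "i < q" "b = (- (int i * int p)) mod int M"
        by (auto simp: B_def)
      have "(x - - (int i * int p)) mod int M \<in> A"
        using b unfolding i(2) mod_diff_right_eq by blast
      then have "i \<in> I x" using i(1) by (simp add: I_def)
      then show "b = (- (int (\<iota> x) * int p)) mod int M"
        using i \<iota> by simp
    qed
  qed
qed

section \<open>Reduction to weak tilings and the case analysis\<close>

lemma pd_tile_imp_weak_tiling: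
  assumes "pd_tile M A" "M > 0"
  obtains f where "weak_tiling M A f"
proof -
  obtain f where A: "A \<subseteq> {0..<int M}" and f0: "f 0 = 1" and nonneg: "\<And>x. x \<in> {0..<int M} \<Longrightarrow> f x \<ge> 0"
    and conv: "\<And>x. x \<in> {0..<int M} \<Longrightarrow> cyclic_conv M (indicator A) f x = (1::real)"
    using assms unfolding pd_tile_def by (auto simp: carrier_integer_mod_group)
  define g where "g x = f (x mod int M)" for x
  have "(\<Sum>y<M. residue_indicator M A (x - int y) * g (int y)) = 1" for x
  proof -
    have "1 = cyclic_conv M (indicator A) f (x mod int M)"
      using conv assms(2) by simp
    also have "\<dots> = (\<Sum>y\<in>{int 0..<int M}. indicator A ((x - y) mod int M) * f y)"
      unfolding cyclic_conv_def using assms(2)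
      by (intro sum.cong) (auto simp: carrier_integer_mod_group mod_add_eq)
    also have "\<dots> = (\<Sum>y<M. residue_indicator M A (x - int y) * g (int y))"
      unfolding sum.atLeast_int_lessThan_int_shift
      by (intro sum.cong) (auto simp: g_def residue_indicator_def indicator_def)
    finally show ?thesis by simp
  qed
  then have "weak_tiling M A g"
    using A f0 nonneg assms(2) by (simp add: weak_tiling_def g_def periodic_def)
  then show ?thesis using that by blast
qed

text \<open>If a step by \<open>p\<close> changes \<open>h\<close> at one point, the two values are
  0 and 1; steps by \<open>q\<close> alter both equally, hence not at all. Coprimality spreads this
  invariance to every point.\<close>

lemma shift_invariant_dichotomy:
  assumes "coprime p q" "p > 0" "q > 0"
    and zero: "\<And>\<xi>. \<not> int p dvd \<xi> \<Longrightarrow> \<not> int q dvd \<xi> \<Longrightarrow> dft (p * q) (residue_indicator (p * q) A) \<xi> = 0"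
  shows "(\<forall>x. residue_indicator (p * q) A (x + int p) = (residue_indicator (p * q) A x :: nat)) \<or>
    (\<forall>x. residue_indicator (p * q) A (x + int q) = (residue_indicator (p * q) A x :: nat))"
proof -
  define h :: "int \<Rightarrow> nat" where "h = residue_indicator (p * q) A"
  have h01: "h x = 0 \<or> h x = 1" for x
    by (simp add: h_def residue_indicator_def)
  have sd: "int (h (x + i * int p + j * int q)) - int (h (x + i * int p)) =
      int (h (x + j * int q)) - int (h x)" for x i j
  proof -
    have h: "residue_indicator (p * q) A = (\<lambda>y. complex_of_int (int (h y)))"
      by (simp add: h_def residue_indicator_def fun_eq_iff)
    have "periodic (p * q) (\<lambda>y. complex_of_int (int (h y)))"
      unfolding h[symmetric] by (rule periodic_residue_indicator)
    from dft_zero_imp_second_difference[OF assms(2,3) this, of x i j]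
    have "complex_of_int (int (h (x + i * int p + j * int q)) - int (h (x + i * int p))) =
        complex_of_int (int (h (x + j * int q)) - int (h x))"
      using zero unfolding h by simp
    then show ?thesis by (simp only: of_int_eq_iff)
  qed
  have "h (y + int q) = h y" if x: "h (x + int p) \<noteq> h x" for x y
  proof -
    have col: "h (x + j * int q) = h x" for j
      using sd[of x 1 j] x h01[of x] h01[of "x + int p"] h01[of "x + j * int q"] h01[of "x + int p + j * int q"]
      by (elim disjE) simp_all
    obtain u v where uv: "u * int p + v * int q = 1"
      using bezout_int[of "int p" "int q"] assms(1) by auto
    define i j where "i = (y - x) * u" and "j = (y - x) * v"
    have "y - x = (y - x) * (u * int p + v * int q)" using uv by simp
    \<comment> \<open>Every \<open>y\<close> is reached from \<open>x\<close> by steps of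
      \<open>p\<close> and \<open>q\<close>, and the second difference moves the increment at
      \<open>y\<close> to the constant column through \<open>x\<close>.\<close>
    then have y: "y = x + j * int q + i * int p"
      by (simp add: i_def j_def algebra_simps)
    have "int (h (y + int q)) - int (h y) = int (h (x + j * int q + 1 * int q)) - int (h (x + j * int q))"
      using sd[of "x + j * int q" i 1] by (simp add: y algebra_simps)
    also have "x + j * int q + 1 * int q = x + (j + 1) * int q"
      by (simp add: algebra_simps)
    finally show ?thesis
      by (simp add: col)
  qed
  then show ?thesis unfolding h_def by blast
qed

lemma of_real_shift_invariant:
  assumes "weak_tiling (p * q) A f" "p > 0" "q > 0"
    and "\<And>\<xi>. \<not> int q dvd \<xi> \<Longrightarrow> dft (p * q) (\<lambda>x. of_real (f x)) \<xi> = 0"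
  shows "f (x + int p) = f x"
proof -
  have "periodic (p * q) (\<lambda>x. complex_of_real (f x))"
    using assms(1) by (simp add: weak_tiling_def periodic_def)
  then have "complex_of_real (f (x + int p)) = of_real (f x)"
    using dft_zero_imp_shift_invariant[OF assms(2,3) _ assms(4)] by blast
  then show ?thesis by (simp only: of_real_eq_iff)
qed

theorem theorem1p3:
  fixes p q :: nat and A :: "int set"
  assumes "prime p" and "prime q" and "p \<noteq> q"
    and "A \<subseteq> carrier (integer_mod_group (p * q))"
    and "pd_tile (p * q) A"
  shows "translational_tile (p * q) A"
proof -
  define M where "M = p * q"
  have p: "p > 0" and q: "q > 0" using assms by (auto simp: prime_gt_0_nat)
  have M: "M > 0" using p q by (simp add: M_def)
  have cop: "coprime p q" using assms by (simp add: primes_coprime)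
  obtain f where wt: "weak_tiling M A f"
    using pd_tile_imp_weak_tiling assms(5) M by (metis M_def)
  \<comment> \<open>Both orders of the product are kept so that the asymmetric lemmas apply with
    \<open>p\<close> and \<open>q\<close> exchanged.\<close>
  have wt': "weak_tiling (p * q) A f" "weak_tiling (q * p) A f"
    using wt by (simp_all add: M_def mult.commute)
  define D where "D = dft M (residue_indicator M A)"
  define F where "F = dft M (\<lambda>x. of_real (f x))"
  have DF: "D \<xi> = 0 \<or> F \<xi> = 0" if "\<not> int M dvd \<xi>" for \<xi>
    using weak_tiling_dft_zero[OF wt M that] by (simp add: D_def F_def)
  have pc: "coprime \<xi> (int r)" if "prime r" "\<not> int r dvd \<xi>" for r :: nat and \<xi>
    using prime_imp_coprime[of "int r" \<xi>] that by (simp add: coprime_commute)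
  have D1: "D \<xi> = 0 \<longleftrightarrow> D 1 = 0" if "\<not> int p dvd \<xi>" "\<not> int q dvd \<xi>" for \<xi>
  proof -
    have "coprime \<xi> (int M)"
      using that pc assms(1,2) by (simp add: M_def)
    then show ?thesis
      unfolding D_def using dft_residue_indicator_galois[of M 1 M \<xi> A] M by simp
  qed
  have Dq: "D \<xi> = 0 \<longleftrightarrow> D (int q) = 0" if "int q dvd \<xi>" "\<not> int M dvd \<xi>" for \<xi>
  proof -
    from that(1) obtain \<eta> where \<eta>: "\<xi> = int q * \<eta>" by (auto elim: dvdE)
    then have "coprime \<eta> (int p)"
      using that(2) pc[OF assms(1)] q by (simp add: M_def mult.commute)
    then show ?thesis
      unfolding D_def \<eta> using M by (intro dft_residue_indicator_galois) (auto simp: M_def)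
  qed
  have Dp: "D \<xi> = 0 \<longleftrightarrow> D (int p) = 0" if "int p dvd \<xi>" "\<not> int M dvd \<xi>" for \<xi>
  proof -
    from that(1) obtain \<eta> where \<eta>: "\<xi> = int p * \<eta>" by (auto elim: dvdE)
    then have "coprime \<eta> (int q)"
      using that(2) pc[OF assms(2)] p by (simp add: M_def)
    then show ?thesis
      unfolding D_def \<eta> using M by (intro dft_residue_indicator_galois) (auto simp: M_def)
  qed
  have dvdM: "int p dvd \<xi>" "int q dvd \<xi>" if "int M dvd \<xi>" for \<xi>
    using that by (auto simp: M_def dest: dvd_mult_left dvd_mult_right)
  have Mdvd: "int M dvd \<xi>" if "int p dvd \<xi>" "int q dvd \<xi>" for \<xi>
    using that cop by (simp add: M_def divides_mult)
  \<comment> \<open>The frequencies 1, \<open>q\<close> and \<open>p\<close> represent the orders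
    \<open>p * q\<close>, \<open>p\<close> and \<open>q\<close>.\<close>
  consider (pq) "D 1 = 0" | (both) "D (int p) = 0" "D (int q) = 0"
    | (p) "D 1 \<noteq> 0" "D (int p) = 0" "D (int q) \<noteq> 0"
    | (q) "D 1 \<noteq> 0" "D (int p) \<noteq> 0" "D (int q) = 0"
    | (none) "D 1 \<noteq> 0" "D (int p) \<noteq> 0" "D (int q) \<noteq> 0"
    by blast
  then show ?thesis
  proof cases
    case pq
    have "(\<forall>x. residue_indicator (p * q) A (x + int p) = (residue_indicator (p * q) A x :: nat)) \<or>
        (\<forall>x. residue_indicator (p * q) A (x + int q) = (residue_indicator (p * q) A x :: nat))"
      using D1 pq by (intro shift_invariant_dichotomy[OF cop p q]) (auto simp: D_def M_def)
    then show ?thesis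
      using translational_tile_if_shift_invariant[OF wt'(1) assms(1) q]
        translational_tile_if_shift_invariant[OF wt'(2) assms(2) p]
      by (auto simp: mult.commute)
  next
    case both
    have cp: "p * card {i. i < q \<and> (0 + int i * int p) mod int (p * q) \<in> A} = card A"
      using Dq both by (intro weak_tiling_fibre_card[OF wt'(1) p q]) (auto simp: D_def M_def)
    have cq: "q * card {i. i < p \<and> (0 + int i * int q) mod int (q * p) \<in> A} = card A"
      using Dp both by (intro weak_tiling_fibre_card[OF wt'(2) q p]) (auto simp: D_def M_def mult.commute)
    have "p dvd card A" and "q dvd card A"
      using dvdI[OF cp[symmetric]] dvdI[OF cq[symmetric]] by blast+
    then have "M dvd card A"
      using cop by (simp add: M_def divides_mult)
    then show ?thesis
      using translational_tile_if_full_card[OF wt M] weak_tiling_card_pos[OF wt M] by (simp add: M_def dvd_imp_le)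
  next
    case q
    \<comment> \<open>Frequencies not divisible by \<open>q\<close> have order \<open>p * q\<close>
      or \<open>q\<close>, where \<open>D\<close> does not vanish.\<close>
    have "F \<xi> = 0" if "\<not> int q dvd \<xi>" for \<xi>
      using that q D1[of \<xi>] Dp[of \<xi>] DF[of \<xi>] dvdM by blast
    then have "f (x + int p) = f x" for x
      by (intro of_real_shift_invariant[OF wt'(1) \<open>p > 0\<close> \<open>q > 0\<close>]) (simp add: F_def M_def)
    then show ?thesis
      using q Dq by (intro translational_tile_if_transversal[OF wt'(1) \<open>p > 0\<close> \<open>q > 0\<close>]) (auto simp: D_def M_def)
  next
    case p
    have "F \<xi> = 0" if "\<not> int p dvd \<xi>" for \<xi>
      using that p D1[of \<xi>] Dq[of \<xi>] DF[of \<xi>] dvdM by blast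
    then have "f (x + int q) = f x" for x
      by (intro of_real_shift_invariant[OF wt'(2) \<open>q > 0\<close> \<open>p > 0\<close>]) (simp add: F_def M_def mult.commute)
    then have "translational_tile (q * p) A"
      using p Dp by (intro translational_tile_if_transversal[OF wt'(2) \<open>q > 0\<close> \<open>p > 0\<close>])
        (auto simp: D_def M_def mult.commute)
    then show ?thesis by (simp add: mult.commute)
  next
    case none
    have F: "F \<xi> = 0" if "\<not> int M dvd \<xi>" for \<xi>
      using that none D1[of \<xi>] Dp[of \<xi>] Dq[of \<xi>] DF[of \<xi>] by blast
    have per: "periodic M (\<lambda>x. complex_of_real (f x))"
      using wt by (simp add: weak_tiling_def periodic_def)
    \<comment> \<open>Here \<open>f\<close> is constant, so \<open>f 0 = 1\<close> makes its mass
      \<open>M\<close>.\<close>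
    have "complex_of_real (real M * f 0) = of_real (\<Sum>z<M. f (int z))"
      using dft_concentrated_imp_const[OF M per, of 0] F by (simp add: F_def dft_0)
    then have "real M = (\<Sum>z<M. f (int z))"
      using wt by (simp only: of_real_eq_iff) (simp add: weak_tiling_def)
    then have "card A = 1"
      using weak_tiling_card[OF wt M] M by simp
    then obtain a where "A = {a}" by (rule card_1_singletonE)
    then show ?thesis
      using translational_tile_singleton[OF M] wt by (simp add: weak_tiling_def M_def)
  qed
qed

end
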